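(* Let $(\Phi,\Delta)$ be a weakly hyperbolic based root system in a Lorentzian $(n+1)$-space $(V,B)$, with associated Coxeter group $W\subseteq \mathrm{O}_B(V)$, and fix a basis $(e_1,\dots,e_{n+1})$ of $V$ and the affine hyperplane $\mathcal H=\{x_{n+1}=1\}$ as described in the context. Then the limit set $\Lambda(W)$ of $W$, acting on the projective model $\mathbb H^n_p=Q^-\cap\mathcal H$, is equal to the set $E(\Phi)$ of limit roots of $\Phi$.
   Context: $V$ is a real vector space of dimension $n+1$ with a symmetric bilinear form $B$ of signature $(n,1)$ (a Lorentzian space); $q(v)=B(v,v)$, $Q=\{v: q(v)=0\}$, $Q^-=\{v:q(v)<0\}$. For $\alpha$ with $B(\alpha,\alpha)=1$, the $B$-reflection is $s_\alpha(v)=v-2B(\alpha,v)\alpha$. A simple system is a finite subset $\Delta\subset V$ such that: (i) $\Delta$ is positively independent (if $\sum_{\alpha\in\Delta}\lambda_\alpha\alpha=0$ with all $\lambda_\alpha\ge0$ then all $\lambda_\alpha=0$); (ii) for $\alpha\ne\beta$ in $\Delta$, $B(\alpha,\beta)\in\,]-\infty,-1]\cup\{-\cos(\pi/k):k\in\mathbb Z_{\ge2}\}$; (iii) $B(\alpha,\alpha)=1$ for all $\alpha\in\Delta$. $W$ is the subgroup of $\mathrm{O}_B(V)$ generated by $S=\{s_\alpha:\alpha\in\Delta\}$, $\Phi=W(\Delta)$ is the root system, $\Phi^+=\Phi\cap\operatorname{cone}(\Delta)$ the positive roots. The root system is weakly hyperbolic if $\operatorname{span}(\Delta)=V$. Fix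 a basis $(e_1,\dots,e_{n+1})$ of $V$ in which $q(v)=x_1^2+\dots+x_n^2-x_{n+1}^2$, such that the affine hyperplane $\mathcal H=\{x_{n+1}=1\}$ meets every line $\mathbb R\beta$, $\beta\in\Phi^+$ (transverse to $\Phi^+$), and $B(e_{n+1},\alpha)<0$ for all $\alpha\in\Delta$ (such a basis exists). For $v$ not in the linear hyperplane directing $\mathcal H$, $\widehat v$ denotes the intersection point of $\mathbb Rv$ with $\mathcal H$. The set of limit roots $E(\Phi)$ is the set of accumulation points of $\widehat\Phi=\{\widehat\beta:\beta\in\Phi\}$. The projective model $\mathbb H^n_p$ of hyperbolic $n$-space is the open unit ball $Q^-\cap\mathcal H$ (isometric via $v\mapsto v/\sqrt{|q(v)|}$ to the hyperboloid $\{q=-1,x_{n+1}>0\}$), with boundary $Q\cap\mathcal H$; $W$ acts on it by $w\cdot x=\widehat{w(x)}$, as a discrete group of hyperbolic isometries. The limit set $\Lambda(W)$ is the set of accumulation points of the orbit $W\cdot x_0$ for any $x_0\in\mathbb H^n_p$ (independent of $x_0$); it lies in $Q\cap\mathcal H$. *)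

theory Defs
  imports "HOL-Analysis.Analysis"
begin

text \<open>Conventions. The Lorentzian space V of dimension n+1 is realised as
  'a \<times> real, with 'a a Euclidean space of dimension n (coordinates x_1..x_n) and
  the second component the coordinate x_(n+1) in the fixed basis (e_1,...,e_(n+1)).
  In this basis q(v) = x_1^2+...+x_n^2 - x_(n+1)^2, so B is the standard Minkowski form.\<close>

definition lorB :: "('a::euclidean_space \<times> real) \<Rightarrow> ('a \<times> real) \<Rightarrow> real" where
  "lorB u v = fst u \<bullet> fst v - snd u * snd v"

definition lorq :: "('a::euclidean_space \<times> real) \<Rightarrow> real" where
  "lorq v = lorB v v"

definition e_last :: "'a::euclidean_space \<times> real" where
  "e_last = (0, 1)"

definition lor_refl :: "('a::euclidean_space \<times> real) \<Rightarrow> ('a \<times> real) \<Rightarrow> ('a \<times> real)" where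
  "lor_refl \<alpha> v = v - (2 * lorB \<alpha> v) *\<^sub>R \<alpha>"

definition positively_independent :: "('a::euclidean_space \<times> real) set \<Rightarrow> bool" where
  "positively_independent D \<longleftrightarrow>
     (\<forall>c. (\<forall>\<alpha>\<in>D. c \<alpha> \<ge> 0) \<and> (\<Sum>\<alpha>\<in>D. c \<alpha> *\<^sub>R \<alpha>) = 0 \<longrightarrow> (\<forall>\<alpha>\<in>D. c \<alpha> = 0))"

definition simple_system :: "('a::euclidean_space \<times> real) set \<Rightarrow> bool" where
  "simple_system D \<longleftrightarrow> finite D \<and> positively_independent D
     \<and> (\<forall>\<alpha>\<in>D. \<forall>\<beta>\<in>D. \<alpha> \<noteq> \<beta> \<longrightarrow>
           lorB \<alpha> \<beta> \<le> -1 \<or> (\<exists>k::nat. k \<ge> 2 \<and> lorB \<alpha> \<beta> = - cos (pi / real k)))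
     \<and> (\<forall>\<alpha>\<in>D. lorB \<alpha> \<alpha> = 1)"

text \<open>The group W generated by the reflections s_\<alpha>, \<alpha> \<in> D (the reflections are
  involutions, so the monoid they generate is the group they generate).\<close>
inductive_set coxeter_group :: "('a::euclidean_space \<times> real) set \<Rightarrow> (('a \<times> real) \<Rightarrow> ('a \<times> real)) set"
  for D where
  id_in: "id \<in> coxeter_group D"
| refl_comp: "\<alpha> \<in> D \<Longrightarrow> w \<in> coxeter_group D \<Longrightarrow> lor_refl \<alpha> \<circ> w \<in> coxeter_group D"

definition root_system :: "('a::euclidean_space \<times> real) set \<Rightarrow> ('a \<times> real) set" where
  "root_system D = {w \<alpha> | w \<alpha>. w \<in> coxeter_group D \<and> \<alpha> \<in> D}"

definition pos_cone :: "('a::euclidean_space \<times> real) set \<Rightarrow> ('a \<times> real) set" where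
  "pos_cone D = {\<Sum>\<alpha>\<in>D. c \<alpha> *\<^sub>R \<alpha> | c. \<forall>\<alpha>\<in>D. c \<alpha> \<ge> 0}"

definition positive_roots :: "('a::euclidean_space \<times> real) set \<Rightarrow> ('a \<times> real) set" where
  "positive_roots D = root_system D \<inter> pos_cone D"

text \<open>Intersection of the line through v with the affine hyperplane H = {x_(n+1) = 1}.\<close>
definition hat :: "('a::euclidean_space \<times> real) \<Rightarrow> ('a \<times> real)" where
  "hat v = (1 / snd v) *\<^sub>R v"

definition H_aff :: "('a::euclidean_space \<times> real) set" where
  "H_aff = {v. snd v = 1}"

definition proj_model :: "('a::euclidean_space \<times> real) set" where
  "proj_model = {v. lorq v < 0} \<inter> H_aff"

definition limit_roots :: "('a::euclidean_space \<times> real) set \<Rightarrow> ('a \<times> real) set" where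
  "limit_roots D = {x. x islimpt {hat \<beta> | \<beta>. \<beta> \<in> root_system D \<and> snd \<beta> \<noteq> 0}}"

definition orbit_limit_points :: "('a::euclidean_space \<times> real) set \<Rightarrow> ('a \<times> real) \<Rightarrow> ('a \<times> real) set" where
  "orbit_limit_points D x0 = {x. x islimpt {hat (w x0) | w. w \<in> coxeter_group D}}"

end

theory Submission
  imports Defs
begin

text \<open>The base point \<open>e_last\<close> lies in the open fundamental chamber.  By Tits' lemma (an element
  whose length is not decreased by the simple reflection of \<open>\<alpha>\<close> maps \<open>\<alpha>\<close> to a positive root)
  every nontrivial element of the group moves the base point by a definite amount, so that the
  orbit is uniformly discrete.  Consequently the last coordinate tends to infinity along every
  family of orbit points or roots whose directions accumulate.  Two such families have the same
  limit directions as soon as the products \<open>B\<close> of their normalised members tend to 0, because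
  \<open>|p - r|^2 = q(p) + q(r) - 2 B(p, r)\<close> for \<open>p\<close> and \<open>r\<close> in the affine hyperplane.  This is applied
  to the orbits of two points, to \<open>w e_last\<close> and \<open>w \<alpha>\<close>, and to \<open>\<beta>\<close> and the reflection of
  \<open>e_last\<close> along \<open>\<beta>\<close>.\<close>

section \<open>The Minkowski form\<close>

lemma lorB_commute: "lorB u v = lorB v u"
  by (simp add: lorB_def inner_commute)

lemma lorB_simps [simp]:
  "lorB (u + v) x = lorB u x + lorB v x"
  "lorB x (u + v) = lorB x u + lorB x v"
  "lorB (u - v) x = lorB u x - lorB v x"
  "lorB x (u - v) = lorB x u - lorB x v"
  "lorB (c *\<^sub>R u) x = c * lorB u x"
  "lorB x (c *\<^sub>R u) = c * lorB x u"
  "lorB (- u) x = - lorB u x"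
  "lorB x (- u) = - lorB x u"
  by (simp_all add: lorB_def algebra_simps)

lemma linear_lorB: "linear (lorB x)"
  by (rule linearI) simp_all

lemma lorB_e_last [simp]:
  "lorB e_last v = - snd v"
  "lorB v e_last = - snd v"
  by (simp_all add: lorB_def e_last_def)

lemma snd_e_last [simp]: "snd e_last = 1"
  by (simp add: e_last_def)

lemma lorq_e_last [simp]: "lorq e_last = -1"
  by (simp add: lorq_def)

lemma lorq_eq: "lorq v = (norm (fst v))\<^sup>2 - (snd v)\<^sup>2"
  by (simp add: lorq_def lorB_def power2_norm_eq_inner power2_eq_square[of "snd v"])

lemma lorq_le_norm: "lorq v \<le> (norm v)\<^sup>2"
  by (simp add: lorq_eq norm_prod_def)

lemma lorq_diff: "lorq (u - v) = lorq u + lorq v - 2 * lorB u v"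
  by (simp add: lorq_def lorB_commute[of v u])

lemma dist_eq_lorq: "snd u = snd v \<Longrightarrow> (dist u v)\<^sup>2 = lorq (u - v)"
  by (simp add: dist_norm lorq_eq norm_prod_def)

definition future_cone :: "('a::euclidean_space \<times> real) set" where
  "future_cone = {v. norm (fst v) < snd v}"

lemma future_cone_iff: "v \<in> future_cone \<longleftrightarrow> lorq v < 0 \<and> snd v > 0"
proof -
  have "norm (fst v) < snd v \<longleftrightarrow> (norm (fst v))\<^sup>2 < (snd v)\<^sup>2" if "snd v > 0"
    using that power_mono_iff[of "snd v" "norm (fst v)" 2] by (simp flip: not_le)
  moreover have "snd v > 0" if "norm (fst v) < snd v"
    using norm_ge_zero that by (rule le_less_trans)
  ultimately show ?thesis
    by (auto simp: future_cone_def lorq_eq)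
qed

lemma e_last_in_future_cone: "e_last \<in> future_cone"
  by (simp add: future_cone_iff)

lemma proj_model_subset_future_cone: "proj_model \<subseteq> future_cone"
  by (auto simp: proj_model_def H_aff_def future_cone_iff)

lemma minus_lorB_ge:
  assumes "y \<in> future_cone"
  shows "(snd x - norm (fst x)) * snd y \<le> - lorB x y"
proof -
  have "fst x \<bullet> fst y \<le> norm (fst x) * norm (fst y)"
    by (rule norm_cauchy_schwarz)
  also have "\<dots> \<le> norm (fst x) * snd y"
    using assms by (simp add: future_cone_def mult_left_mono)
  finally show ?thesis
    by (simp add: lorB_def algebra_simps)
qed

lemma lorB_future_cone_neg:
  assumes "x \<in> future_cone" "y \<in> future_cone"
  shows "lorB x y < 0"
proof -
  have "0 < (snd x - norm (fst x)) * snd y"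
    using assms future_cone_iff[of y] by (simp add: future_cone_def)
  with minus_lorB_ge[OF assms(2), of x] show ?thesis
    by linarith
qed

lemma future_coneI:
  assumes "v \<in> future_cone" "lorq u < 0" "lorB u v < 0"
  shows "u \<in> future_cone"
proof (rule ccontr)
  assume "u \<notin> future_cone"
  then have "- u \<in> future_cone"
    using assms(2) by (cases "snd u" "0 :: real" rule: linorder_cases)
      (auto simp: future_cone_iff lorq_eq)
  then show False
    using lorB_future_cone_neg[OF _ assms(1)] assms(3) by fastforce
qed

section \<open>Reflections\<close>

lemma linear_lor_refl: "linear (lor_refl \<alpha>)"
  by (rule linearI) (simp_all add: lor_refl_def algebra_simps)

lemma lor_refl_self: "lorB \<alpha> \<alpha> = 1 \<Longrightarrow> lor_refl \<alpha> \<alpha> = - \<alpha>"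
  by (simp add: lor_refl_def scaleR_2)

lemma lor_refl_orthogonal: "lorB \<alpha> v = 0 \<Longrightarrow> lor_refl \<alpha> v = v"
  by (simp add: lor_refl_def)

lemma lor_refl_e_last: "lor_refl \<beta> e_last = e_last + (2 * snd \<beta>) *\<^sub>R \<beta>"
  by (simp add: lor_refl_def)

lemma snd_lor_refl_e_last: "snd (lor_refl \<beta> e_last) = 1 + 2 * (snd \<beta>)\<^sup>2"
  by (simp add: lor_refl_e_last power2_eq_square)

lemma lor_refl_comp_self: "lorB \<alpha> \<alpha> = 1 \<Longrightarrow> lor_refl \<alpha> \<circ> lor_refl \<alpha> = id"
  by (simp add: fun_eq_iff lor_refl_def algebra_simps)

lemma lor_refl_comp_cancel: "lorB \<alpha> \<alpha> = 1 \<Longrightarrow> lor_refl \<alpha> \<circ> (lor_refl \<alpha> \<circ> f) = f"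
  by (simp add: lor_refl_comp_self flip: comp_assoc)

lemma lorB_lor_refl: "lorB \<alpha> \<alpha> = 1 \<Longrightarrow> lorB (lor_refl \<alpha> u) (lor_refl \<alpha> v) = lorB u v"
  by (simp add: lor_refl_def algebra_simps lorB_commute)

lemma lor_refl_future_cone:
  assumes "lorB \<alpha> \<alpha> = 1" "v \<in> future_cone"
  shows "lor_refl \<alpha> v \<in> future_cone"
proof (rule future_coneI[OF assms(2)])
  have q: "lorq v < 0"
    using assms(2) by (simp add: future_cone_iff)
  then show "lorq (lor_refl \<alpha> v) < 0"
    using assms(1) by (simp add: lorq_def lorB_lor_refl)
  have "lorB (lor_refl \<alpha> v) v = lorq v - 2 * (lorB \<alpha> v)\<^sup>2"
    by (simp add: lor_refl_def lorq_def power2_eq_square)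
  also have "\<dots> < 0"
    using q by (smt (verit) zero_le_power2)
  finally show "lorB (lor_refl \<alpha> v) v < 0" .
qed

section \<open>Accumulation of directions\<close>

lemma islimpt_image_filter:
  fixes f :: "'i \<Rightarrow> 'b::t1_space" and h :: "'i \<Rightarrow> 'c::linorder"
  assumes lim: "x islimpt f ` A" and fin: "\<And>M. finite (f ` {i \<in> A. h i \<le> M})"
  obtains F where "F \<noteq> bot" "\<forall>\<^sub>F i in F. i \<in> A" "(f \<longlongrightarrow> x) F" "filterlim h at_top F"
proof -
  define F where "F = inf (filtercomap f (at x)) (principal A)"
  have "\<not> (\<forall>\<^sub>F i in F. False)"
  proof
    assume "\<forall>\<^sub>F i in F. False"
    then obtain P where "eventually P (at x)" "\<And>i. i \<in> A \<Longrightarrow> \<not> P (f i)"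
      by (auto simp: F_def eventually_inf_principal eventually_filtercomap)
    then have "\<forall>\<^sub>F y in at x. y \<notin> f ` A"
      by (auto elim: eventually_mono)
    with lim show False
      by (simp add: islimpt_iff_eventually)
  qed
  then have "F \<noteq> bot"
    by (simp add: trivial_limit_def)
  moreover have A: "\<forall>\<^sub>F i in F. i \<in> A"
    by (simp add: F_def eventually_inf_principal)
  moreover have f: "filterlim f (at x) F"
    unfolding F_def by (rule filterlim_mono[OF filterlim_filtercomap]) auto
  then have "(f \<longlongrightarrow> x) F"
    by (simp add: filterlim_at)
  moreover have "filterlim h at_top F"
    unfolding filterlim_at_top
  proof
    fix M
    have "\<forall>\<^sub>F y in at x. y \<notin> f ` {i \<in> A. h i \<le> M}"
      using islimpt_finite[OF fin] by (simp add: islimpt_iff_eventually)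
    then have "\<forall>\<^sub>F i in F. f i \<notin> f ` {i \<in> A. h i \<le> M}"
      using f by (rule eventually_compose_filterlim)
    with A show "\<forall>\<^sub>F i in F. M \<le> h i"
      by eventually_elim force
  qed
  ultimately show ?thesis
    using that by blast
qed

lemma islimpt_if_tendsto:
  assumes "F \<noteq> bot" "(f \<longlongrightarrow> x) F" "\<forall>\<^sub>F i in F. f i \<in> S \<and> f i \<noteq> x"
  shows "x islimpt S"
  unfolding islimpt_iff_eventually
proof
  assume "\<forall>\<^sub>F y in at x. y \<notin> S"
  moreover have "filterlim f (at x) F"
    using assms by (simp add: filterlim_at eventually_conj_iff)
  ultimately have "\<forall>\<^sub>F i in F. f i \<notin> S"
    by (rule eventually_compose_filterlim)
  with assms(3) have "\<forall>\<^sub>F i in F. False"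
    by eventually_elim simp
  with assms(1) show False
    by (simp add: trivial_limit_def)
qed

lemma Bfun_divide_tendsto_0:
  fixes f g :: "'i \<Rightarrow> 'b::real_normed_field"
  assumes "Bfun f F" "filterlim g at_infinity F"
  shows "((\<lambda>i. f i / g i) \<longlongrightarrow> 0) F"
proof -
  have "Zfun (\<lambda>i. inverse (g i)) F"
    using filterlim_compose[OF tendsto_inverse_0 assms(2)] by (simp add: tendsto_Zfun_iff)
  then have "Zfun (\<lambda>i. f i * inverse (g i)) F"
    by (rule bounded_bilinear.Bfun_prod_Zfun[OF bounded_bilinear_mult assms(1)])
  then show ?thesis
    by (simp add: tendsto_Zfun_iff divide_inverse)
qed

lemma lorB_hat: "lorB (hat u) (hat v) = lorB u v / (snd u * snd v)"
  by (simp add: hat_def)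

lemma lorB_hat_tendsto_0:
  assumes "Bfun (\<lambda>i. lorB (u i) (v i)) F"
    and "filterlim (\<lambda>i. snd (u i)) at_infinity F" "filterlim (\<lambda>i. snd (v i)) at_infinity F"
  shows "((\<lambda>i. lorB (hat (u i)) (hat (v i))) \<longlongrightarrow> 0) F"
  unfolding lorB_hat using assms by (intro Bfun_divide_tendsto_0 filterlim_at_infinity_times)

lemma tendsto_H_aff_transfer:
  assumes "\<forall>\<^sub>F i in F. p i \<in> H_aff \<and> r i \<in> H_aff"
    and "((\<lambda>i. lorq (p i)) \<longlongrightarrow> 0) F" "((\<lambda>i. lorq (r i)) \<longlongrightarrow> 0) F"
    and "((\<lambda>i. lorB (p i) (r i)) \<longlongrightarrow> 0) F" and "(r \<longlongrightarrow> x) F"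
  shows "(p \<longlongrightarrow> x) F"
proof -
  have "((\<lambda>i. lorq (p i - r i)) \<longlongrightarrow> 0 + 0 - 2 * 0) F"
    unfolding lorq_diff using assms by (intro tendsto_intros)
  moreover have "\<forall>\<^sub>F i in F. lorq (p i - r i) = (dist (p i) (r i))\<^sup>2"
    using assms(1) by eventually_elim (simp add: H_aff_def dist_eq_lorq)
  ultimately have "((\<lambda>i. (dist (p i) (r i))\<^sup>2) \<longlongrightarrow> 0) F"
    by (simp add: tendsto_cong)
  then have "((\<lambda>i. dist (p i) (r i)) \<longlongrightarrow> 0) F"
    using tendsto_real_sqrt by fastforce
  then have "((\<lambda>i. p i - r i) \<longlongrightarrow> 0) F"
    by (simp add: dist_norm tendsto_norm_zero_iff)
  with assms(5) show ?thesis
    by (rule Lim_transform)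
qed

lemma tendsto_lorq: "(p \<longlongrightarrow> x) F \<Longrightarrow> ((\<lambda>i. lorq (p i)) \<longlongrightarrow> lorq x) F"
  unfolding lorq_def lorB_def by (intro tendsto_intros)

lemma islimpt_hat_transfer:
  fixes u v :: "'i \<Rightarrow> 'a::euclidean_space \<times> real"
  assumes F: "F \<noteq> bot" and lim: "((\<lambda>i. hat (v i)) \<longlongrightarrow> x) F"
    and u_escape: "filterlim (\<lambda>i. snd (u i)) at_infinity F"
    and v_escape: "filterlim (\<lambda>i. snd (v i)) at_infinity F"
    and q: "Bfun (\<lambda>i. lorq (u i)) F" "Bfun (\<lambda>i. lorq (v i)) F"
    and B: "((\<lambda>i. lorB (hat (u i)) (hat (v i))) \<longlongrightarrow> 0) F"
    and S: "\<forall>\<^sub>F i in F. hat (u i) \<in> S \<and> lorq (u i) \<noteq> 0"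
  shows "x islimpt S"
proof (rule islimpt_if_tendsto[OF F])
  have snd_nonzero: "\<forall>\<^sub>F i in F. snd (u i) \<noteq> 0" "\<forall>\<^sub>F i in F. snd (v i) \<noteq> 0"
    using u_escape v_escape by (simp_all add: filterlim_at_infinity_imp_eventually_ne)
  have lorq_hat_0: "((\<lambda>i. lorq (hat (u i))) \<longlongrightarrow> 0) F" "((\<lambda>i. lorq (hat (v i))) \<longlongrightarrow> 0) F"
    using q u_escape v_escape unfolding lorq_def by (simp_all add: lorB_hat_tendsto_0)
  have "\<forall>\<^sub>F i in F. hat (u i) \<in> H_aff \<and> hat (v i) \<in> H_aff"
    using snd_nonzero by eventually_elim (simp add: hat_def H_aff_def)
  then show u: "((\<lambda>i. hat (u i)) \<longlongrightarrow> x) F"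
    using lorq_hat_0 B lim by (rule tendsto_H_aff_transfer)
  have "lorq x = 0"
    using F tendsto_lorq[OF u] lorq_hat_0(1) by (rule tendsto_unique)
  show "\<forall>\<^sub>F i in F. hat (u i) \<in> S \<and> hat (u i) \<noteq> x"
    using S snd_nonzero(1) by eventually_elim (use \<open>lorq x = 0\<close> in \<open>auto simp: lorq_def lorB_hat\<close>)
qed

section \<open>Reflection groups and their length functions\<close>

primrec word :: "('a::euclidean_space \<times> real) list \<Rightarrow> 'a \<times> real \<Rightarrow> 'a \<times> real" where
  word_Nil: "word [] = id"
| word_Cons: "word (\<alpha> # xs) = lor_refl \<alpha> \<circ> word xs"

lemma word_append: "word (xs @ ys) = word xs \<circ> word ys"
  by (induction xs) (simp_all add: comp_assoc)

lemma linear_word: "linear (word xs)"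
proof (induction xs)
  case Nil
  show ?case unfolding word_Nil by (rule linear_id)
next
  case (Cons \<alpha> xs)
  then show ?case unfolding word_Cons by (intro linear_compose linear_lor_refl)
qed

lemma word_orthogonal: "\<forall>\<alpha>\<in>set xs. lorB \<alpha> v = 0 \<Longrightarrow> word xs v = v"
  by (induction xs) (auto simp: lor_refl_orthogonal)

lemma coxeter_group_eq_words: "coxeter_group D = word ` lists D"
proof
  show "coxeter_group D \<subseteq> word ` lists D"
  proof
    fix w assume "w \<in> coxeter_group D"
    then show "w \<in> word ` lists D"
    proof induction
      case id_in
      then show ?case by (metis image_eqI lists.Nil word_Nil)
    next
      case (refl_comp \<alpha> w)
      then show ?case by (metis (no_types, lifting) image_iff lists.Cons word_Cons)
    qed
  qed
  have "xs \<in> lists D \<Longrightarrow> word xs \<in> coxeter_group D" for xs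
    by (induction xs) (auto intro: coxeter_group.intros)
  then show "word ` lists D \<subseteq> coxeter_group D" by auto
qed

lemma word_in_coxeter_group: "xs \<in> lists D \<Longrightarrow> word xs \<in> coxeter_group D"
  by (simp add: coxeter_group_eq_words)

lemma coxeter_group_wordE:
  assumes "w \<in> coxeter_group D"
  obtains xs where "xs \<in> lists D" "w = word xs"
  using assms by (auto simp: coxeter_group_eq_words)

lemma coxeter_group_mono: "D \<subseteq> E \<Longrightarrow> coxeter_group D \<subseteq> coxeter_group E"
  unfolding coxeter_group_eq_words by (intro image_mono lists_mono)

lemma lor_refl_in_coxeter_group: "\<alpha> \<in> D \<Longrightarrow> lor_refl \<alpha> \<in> coxeter_group D"
  using word_in_coxeter_group[of "[\<alpha>]"] by simp

lemma comp_in_coxeter_group: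
  "v \<in> coxeter_group D \<Longrightarrow> w \<in> coxeter_group D \<Longrightarrow> v \<circ> w \<in> coxeter_group D"
  by (elim coxeter_group_wordE) (auto simp flip: word_append intro!: word_in_coxeter_group)

lemma linear_coxeter_group: "w \<in> coxeter_group D \<Longrightarrow> linear w"
  by (elim coxeter_group_wordE) (simp add: linear_word)

definition coxeter_length ::
  "('a::euclidean_space \<times> real) set \<Rightarrow> ('a \<times> real \<Rightarrow> 'a \<times> real) \<Rightarrow> nat" where
  "coxeter_length D w = (LEAST n. \<exists>xs\<in>lists D. word xs = w \<and> length xs = n)"

lemma coxeter_length_word_le: "xs \<in> lists D \<Longrightarrow> coxeter_length D (word xs) \<le> length xs"
  unfolding coxeter_length_def by (rule Least_le) blast

lemma reduced_wordE:
  assumes "w \<in> coxeter_group D"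
  obtains xs where "xs \<in> lists D" "word xs = w" "length xs = coxeter_length D w"
proof -
  have "\<exists>n. \<exists>xs\<in>lists D. word xs = w \<and> length xs = n"
    using assms by (metis coxeter_group_wordE)
  from LeastI_ex[OF this] show ?thesis
    using that unfolding coxeter_length_def by blast
qed

lemma coxeter_length_id [simp]: "coxeter_length D id = 0"
  using coxeter_length_word_le[of "[]" D] by simp

lemma coxeter_length_eq_0_iff: "w \<in> coxeter_group D \<Longrightarrow> coxeter_length D w = 0 \<longleftrightarrow> w = id"
  by (metis coxeter_length_id length_0_conv reduced_wordE word_Nil)

lemma coxeter_length_comp_le:
  assumes "v \<in> coxeter_group D" "w \<in> coxeter_group D"
  shows "coxeter_length D (v \<circ> w) \<le> coxeter_length D v + coxeter_length D w"
proof -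
  obtain xs ys where "xs \<in> lists D" "word xs = v" "length xs = coxeter_length D v"
    and "ys \<in> lists D" "word ys = w" "length ys = coxeter_length D w"
    using assms reduced_wordE by metis
  then show ?thesis
    using coxeter_length_word_le[of "xs @ ys" D] by (simp add: word_append)
qed

lemma coxeter_length_antimono:
  assumes "D \<subseteq> E" "w \<in> coxeter_group D"
  shows "coxeter_length E w \<le> coxeter_length D w"
proof -
  obtain xs where "xs \<in> lists D" "word xs = w" "length xs = coxeter_length D w"
    using assms(2) by (rule reduced_wordE)
  then show ?thesis
    using coxeter_length_word_le[of xs E] lists_mono[OF assms(1)] by auto
qed

lemma coxeter_length_comp_parabolic_le:
  assumes "v \<in> coxeter_group D" "u \<in> coxeter_group E" "E \<subseteq> D"
  shows "coxeter_length D (v \<circ> u) \<le> coxeter_length D v + coxeter_length E u"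
proof -
  have "u \<in> coxeter_group D"
    using assms coxeter_group_mono by blast
  with assms(1) have "coxeter_length D (v \<circ> u) \<le> coxeter_length D v + coxeter_length D u"
    by (rule coxeter_length_comp_le)
  with coxeter_length_antimono[OF assms(3,2)] show ?thesis
    by linarith
qed

lemma parabolic_factor_length_increasing:
  assumes "v \<in> coxeter_group D" "u \<in> coxeter_group E" "E \<subseteq> D" "\<gamma> \<in> E"
    and "coxeter_length D v + coxeter_length E u = coxeter_length D (v \<circ> u)"
    and "coxeter_length D (v \<circ> u) \<le> coxeter_length D (v \<circ> u \<circ> lor_refl \<gamma>)"
  shows "coxeter_length E u \<le> coxeter_length E (u \<circ> lor_refl \<gamma>)"
proof -
  have "u \<circ> lor_refl \<gamma> \<in> coxeter_group E"
    using assms(2,4) by (intro comp_in_coxeter_group lor_refl_in_coxeter_group)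
  with assms(1) have "coxeter_length D (v \<circ> (u \<circ> lor_refl \<gamma>)) \<le>
      coxeter_length D v + coxeter_length E (u \<circ> lor_refl \<gamma>)"
    using assms(3) by (rule coxeter_length_comp_parabolic_le)
  with assms(5,6) show ?thesis
    by (simp add: comp_assoc)
qed

lemma coxeter_length_lor_refl_le: "\<alpha> \<in> D \<Longrightarrow> coxeter_length D (lor_refl \<alpha>) \<le> 1"
  using coxeter_length_word_le[of "[\<alpha>]" D] by simp

locale unit_vectors =
  fixes D :: "('a::euclidean_space \<times> real) set"
  assumes lorB_self: "\<alpha> \<in> D \<Longrightarrow> lorB \<alpha> \<alpha> = 1"
begin

lemma lorB_coxeter_group: "w \<in> coxeter_group D \<Longrightarrow> lorB (w u) (w v) = lorB u v"
  by (induction rule: coxeter_group.induct) (auto simp: lorB_lor_refl lorB_self)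

lemma lorq_coxeter_group: "w \<in> coxeter_group D \<Longrightarrow> lorq (w v) = lorq v"
  by (simp add: lorq_def lorB_coxeter_group)

lemma coxeter_group_future_cone:
  "w \<in> coxeter_group D \<Longrightarrow> v \<in> future_cone \<Longrightarrow> w v \<in> future_cone"
  by (induction rule: coxeter_group.induct) (auto intro: lor_refl_future_cone lorB_self)

lemma word_comp_rev: "xs \<in> lists D \<Longrightarrow> word xs \<circ> word (rev xs) = id"
proof (induction xs)
  case (Cons \<alpha> xs)
  then have "word xs \<circ> (word (rev xs) \<circ> lor_refl \<alpha>) = lor_refl \<alpha>"
    by (simp only: comp_assoc[symmetric] Cons_in_lists_iff id_comp)
  moreover have "word (\<alpha> # xs) \<circ> word (rev (\<alpha> # xs)) =
      lor_refl \<alpha> \<circ> (word xs \<circ> (word (rev xs) \<circ> lor_refl \<alpha>))"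
    by (simp add: word_append comp_assoc)
  ultimately show ?case
    using Cons.prems by (simp only: lor_refl_comp_self lorB_self Cons_in_lists_iff)
qed simp

lemma
  assumes "w \<in> coxeter_group D"
  shows bij_coxeter_group: "bij w" and inv_in_coxeter_group: "inv w \<in> coxeter_group D"
proof -
  obtain xs where xs: "xs \<in> lists D" "w = word xs"
    using assms by (rule coxeter_group_wordE)
  then have w: "w \<circ> word (rev xs) = id" "word (rev xs) \<circ> w = id"
    using word_comp_rev[of xs] word_comp_rev[of "rev xs"] by (auto simp: in_lists_conv_set)
  then show "bij w"
    using o_bij by blast
  show "inv w \<in> coxeter_group D"
    using inv_unique_comp[OF w] xs by (simp add: word_in_coxeter_group in_lists_conv_set)
qed

lemma coxeter_group_apply_inv [simp]: "w \<in> coxeter_group D \<Longrightarrow> w (inv w v) = v"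
  using bij_coxeter_group by (simp add: bij_is_surj surj_f_inv_f)

lemma lorB_inv_coxeter_group: "w \<in> coxeter_group D \<Longrightarrow> lorB (inv w u) v = lorB u (w v)"
  using lorB_coxeter_group[of w "inv w u" v] by simp

lemma lor_refl_image:
  assumes "w \<in> coxeter_group D"
  shows "lor_refl (w \<alpha>) = w \<circ> lor_refl \<alpha> \<circ> inv w"
proof
  fix v
  have "lorB (w \<alpha>) v = lorB \<alpha> (inv w v)"
    using assms by (simp add: lorB_inv_coxeter_group lorB_commute[of \<alpha>] lorB_commute[of "w \<alpha>"])
  then show "lor_refl (w \<alpha>) v = (w \<circ> lor_refl \<alpha> \<circ> inv w) v"
    using linear_coxeter_group[OF assms] assms
    by (simp add: lor_refl_def linear_diff linear_scale)
qed

lemma root_systemE: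
  assumes "\<beta> \<in> root_system D"
  obtains w \<alpha> where "w \<in> coxeter_group D" "\<alpha> \<in> D" "\<beta> = w \<alpha>"
  using assms by (auto simp: root_system_def)

lemma lorq_root: "\<beta> \<in> root_system D \<Longrightarrow> lorq \<beta> = 1"
  by (elim root_systemE) (simp add: lorq_def lorB_coxeter_group lorB_self)

lemma lor_refl_root_in_coxeter_group:
  "\<beta> \<in> root_system D \<Longrightarrow> lor_refl \<beta> \<in> coxeter_group D"
  by (elim root_systemE) (simp add: lor_refl_image comp_in_coxeter_group inv_in_coxeter_group
      lor_refl_in_coxeter_group)

lemma descentE:
  assumes "w \<in> coxeter_group D" "w \<noteq> id"
  obtains \<alpha> where "\<alpha> \<in> D" "coxeter_length D (w \<circ> lor_refl \<alpha>) < coxeter_length D w"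
proof -
  obtain xs where xs: "xs \<in> lists D" "word xs = w" "length xs = coxeter_length D w"
    using assms(1) by (rule reduced_wordE)
  then obtain ys \<alpha> where ys: "xs = ys @ [\<alpha>]"
    using assms(2) by (cases xs rule: rev_cases) auto
  then have "w \<circ> lor_refl \<alpha> = word ys"
    using xs(1) by (simp add: xs(2)[symmetric] word_append comp_assoc lor_refl_comp_self lorB_self)
  then show ?thesis
    using that[of \<alpha>] coxeter_length_word_le[of ys D] xs ys by simp
qed

lemma parabolic_factorization:
  assumes w: "w \<in> coxeter_group D" and E: "E \<subseteq> D"
  obtains v u where "v \<in> coxeter_group D" "u \<in> coxeter_group E" "w = v \<circ> u"
    "coxeter_length D v + coxeter_length E u = coxeter_length D w"
    "\<And>\<gamma>. \<gamma> \<in> E \<Longrightarrow> coxeter_length D v \<le> coxeter_length D (v \<circ> lor_refl \<gamma>)"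
proof -
  define factors where "factors v u \<longleftrightarrow> v \<in> coxeter_group D \<and> u \<in> coxeter_group E \<and> w = v \<circ> u \<and>
    coxeter_length D v + coxeter_length E u = coxeter_length D w" for v u
  have "factors w id"
    using w by (simp add: factors_def coxeter_group.id_in)
  then obtain v u where vu: "factors v u"
    and min: "\<And>v' u'. factors v' u' \<Longrightarrow> coxeter_length D v \<le> coxeter_length D v'"
    using ex_has_least_nat[of "\<lambda>(v, u). factors v u" "(w, id)" "\<lambda>(v, u). coxeter_length D v"]
    by (auto simp: split_paired_all)
  have "coxeter_length D v \<le> coxeter_length D (v \<circ> lor_refl \<gamma>)" if \<gamma>: "\<gamma> \<in> E" for \<gamma>
  proof (rule ccontr)
    assume shorter: "\<not> ?thesis"
    define v' u' where "v' = v \<circ> lor_refl \<gamma>" and "u' = lor_refl \<gamma> \<circ> u"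
    have v': "v' \<in> coxeter_group D" and u': "u' \<in> coxeter_group E"
      using vu \<gamma> E by (auto simp: factors_def v'_def u'_def
          intro!: comp_in_coxeter_group lor_refl_in_coxeter_group)
    have w': "w = v' \<circ> u'"
      using vu \<gamma> E lorB_self[of \<gamma>]
      by (auto simp: factors_def v'_def u'_def comp_assoc lor_refl_comp_cancel)
    have "coxeter_length E u' \<le> coxeter_length E u + 1"
      using vu \<gamma> coxeter_length_comp_le[of "lor_refl \<gamma>" E u] coxeter_length_lor_refl_le[of \<gamma> E]
      by (simp add: factors_def u'_def lor_refl_in_coxeter_group)
    moreover have "coxeter_length D w \<le> coxeter_length D v' + coxeter_length E u'"
      using coxeter_length_comp_parabolic_le[OF v' u' E] w' by simp
    ultimately have "factors v' u'"
      using vu v' u' w' shorter unfolding factors_def v'_def by linarith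
    with min[of v' u'] shorter show False
      by (simp add: v'_def)
  qed
  with vu show ?thesis
    using that by (auto simp: factors_def)
qed

lemma reduced_word_distinct_adj:
  assumes "xs \<in> lists D" "coxeter_length D (word xs) = length xs"
  shows "distinct_adj xs"
proof (rule ccontr)
  assume "\<not> distinct_adj xs"
  then obtain i where i: "Suc i < length xs" "xs ! i = xs ! Suc i"
    by (auto simp: distinct_adj_conv_nth)
  define \<gamma> ys zs where "\<gamma> = xs ! i" and "ys = take i xs" and "zs = drop (Suc (Suc i)) xs"
  have xs: "xs = ys @ [\<gamma>, \<gamma>] @ zs"
    using i id_take_nth_drop[of i xs] by (simp add: \<gamma>_def ys_def zs_def Cons_nth_drop_Suc)
  then have "word xs = word (ys @ zs)"
    using assms(1) by (simp add: word_append lor_refl_comp_cancel lorB_self)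
  then have "coxeter_length D (word xs) \<le> length (ys @ zs)"
    using assms(1) xs coxeter_length_word_le[of "ys @ zs" D] by simp
  with assms(2) xs show False
    by simp
qed

end

section \<open>Dihedral groups\<close>

text \<open>Words grow on the left, so that the last letter is always \<open>b\<close>.\<close>
primrec alt_word :: "'b \<Rightarrow> 'b \<Rightarrow> nat \<Rightarrow> 'b list" where
  "alt_word a b 0 = []"
| "alt_word a b (Suc k) = (if even k then b else a) # alt_word a b k"

lemma length_alt_word [simp]: "length (alt_word a b k) = k"
  by (induction k) auto

lemma set_alt_word: "set (alt_word a b k) \<subseteq> {a, b}"
  by (induction k) auto

lemma alt_word_snoc: "alt_word b a k @ [b] = alt_word a b (Suc k)"
  by (induction k) auto

lemma drop_alt_word: "drop j (alt_word a b (j + k)) = alt_word a b k"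
  by (induction j) auto

lemma distinct_adj_eq_alt_word:
  assumes "distinct_adj xs" "set xs \<subseteq> {a, b}" "xs \<noteq> [] \<Longrightarrow> last xs \<noteq> a"
  shows "xs = alt_word a b (length xs)"
  using assms
proof (induction xs)
  case (Cons x xs)
  show ?case
  proof (cases "length xs")
    case 0
    with Cons.prems show ?thesis by auto
  next
    case (Suc n)
    then have "xs = alt_word a b (Suc n)"
      using Cons.IH Cons.prems by (cases xs) (simp_all add: distinct_adj_Cons)
    with Cons.prems Suc show ?thesis
      by (auto simp: distinct_adj_Cons split: if_splits)
  qed
qed simp

text \<open>Chebyshev polynomials of the second kind, with the index shifted by one.\<close>
fun chebyshev :: "real \<Rightarrow> nat \<Rightarrow> real" where
  "chebyshev c 0 = 0"
| "chebyshev c (Suc 0) = 1"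
| "chebyshev c (Suc (Suc k)) = 2 * c * chebyshev c (Suc k) - chebyshev c k"

lemma chebyshev_cos: "sin \<theta> * chebyshev (cos \<theta>) k = sin (real k * \<theta>)"
proof (induction "cos \<theta>" k rule: chebyshev.induct)
  case (3 k)
  have "sin \<theta> * chebyshev (cos \<theta>) (Suc (Suc k)) =
      2 * cos \<theta> * (sin \<theta> * chebyshev (cos \<theta>) (Suc k)) - sin \<theta> * chebyshev (cos \<theta>) k"
    by (simp add: algebra_simps)
  also have "\<dots> = 2 * cos \<theta> * sin (real (Suc k) * \<theta>) - sin (real (Suc k) * \<theta> - \<theta>)"
    using 3 by (simp add: algebra_simps)
  also have "\<dots> = sin (real (Suc k) * \<theta> + \<theta>)"
    by (simp add: sin_add sin_diff)
  also have "\<dots> = sin (real (Suc (Suc k)) * \<theta>)"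
    by (simp add: algebra_simps)
  finally show ?case .
qed auto

lemma chebyshev_nonneg_mono:
  assumes "c \<ge> 1"
  shows "0 \<le> chebyshev c k \<and> chebyshev c k \<le> chebyshev c (Suc k)"
proof (induction k)
  case (Suc k)
  have "2 * c * chebyshev c (Suc k) \<ge> 2 * chebyshev c (Suc k)"
    using Suc assms mult_right_mono[of 2 "2 * c" "chebyshev c (Suc k)"] by auto
  then show ?case using Suc by simp
qed auto

lemma sin_pi_divide_nat_pos: "m \<ge> 2 \<Longrightarrow> sin (pi / real m) > 0"
  by (intro sin_gt_zero) (auto simp: field_simps)

lemma chebyshev_cos_pi_divide_nonneg:
  assumes "m \<ge> 2" "k \<le> m"
  shows "chebyshev (cos (pi / real m)) k \<ge> 0"
proof -
  have "real k * (pi / real m) \<le> pi"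
    using assms by (simp add: field_simps)
  then have "sin (pi / real m) * chebyshev (cos (pi / real m)) k \<ge> 0"
    by (simp add: chebyshev_cos sin_ge_zero)
  with sin_pi_divide_nat_pos[OF assms(1)] show ?thesis
    by (simp add: zero_le_mult_iff)
qed

lemma
  assumes "m \<ge> 2"
  shows chebyshev_cos_pi_divide: "chebyshev (cos (pi / real m)) m = 0"
    and chebyshev_cos_pi_divide_Suc: "chebyshev (cos (pi / real m)) (Suc m) = -1"
proof -
  define \<theta> where "\<theta> = pi / real m"
  have \<theta>: "sin \<theta> > 0" "real m * \<theta> = pi" "real (Suc m) * \<theta> = \<theta> + pi"
    using assms sin_pi_divide_nat_pos[OF assms] by (auto simp: \<theta>_def field_simps)
  have "sin \<theta> * chebyshev (cos \<theta>) m = sin \<theta> * 0"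
    "sin \<theta> * chebyshev (cos \<theta>) (Suc m) = sin \<theta> * -1"
    unfolding chebyshev_cos \<theta>(2,3) by simp_all
  then have "chebyshev (cos \<theta>) m = 0" "chebyshev (cos \<theta>) (Suc m) = -1"
    using \<theta>(1) by (auto simp only: mult_cancel_left)
  then show "chebyshev (cos (pi / real m)) m = 0" "chebyshev (cos (pi / real m)) (Suc m) = -1"
    by (simp_all add: \<theta>_def)
qed

lemma word_alt_word_first:
  assumes "lorB a a = 1" "lorB b b = 1" "lorB a b = - c"
  shows "word (alt_word a b k) a =
    (if even k then chebyshev c (Suc k) *\<^sub>R a + chebyshev c k *\<^sub>R b
     else chebyshev c (Suc k) *\<^sub>R b + chebyshev c k *\<^sub>R a)"
proof (induction k)
  case (Suc k)
  have "lorB b a = - c" using assms(3) by (simp add: lorB_commute)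
  then show ?case using Suc assms
    by (simp add: lor_refl_def algebra_simps flip: scaleR_2)
qed auto

lemma word_alt_word_last:
  assumes "lorB a a = 1" "lorB b b = 1" "lorB a b = - c"
  shows "word (alt_word a b (Suc k)) b =
    - (if even k then chebyshev c (Suc k) *\<^sub>R b + chebyshev c k *\<^sub>R a
       else chebyshev c (Suc k) *\<^sub>R a + chebyshev c k *\<^sub>R b)"
proof -
  have "word (alt_word a b (Suc k)) b = word (alt_word b a k) (- b)"
    using assms(2) unfolding alt_word_snoc[symmetric] by (simp add: word_append lor_refl_self)
  also have "\<dots> = - word (alt_word b a k) b"
    by (rule linear_neg[OF linear_word])
  finally show ?thesis
    using assms by (simp only: word_alt_word_first lorB_commute[of b a])
qed

lemma word_alt_word_cos_pi:
  assumes "lorB a a = 1" "lorB b b = 1" "lorB a b = - cos (pi / real m)" "m \<ge> 2"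
  shows "word (alt_word a b m) a = (if even m then - a else - b)"
    and "word (alt_word a b m) b = (if even m then - b else - a)"
proof -
  define c where "c = cos (pi / real m)"
  obtain n where n: "m = Suc n"
    using assms(4) by (cases m) auto
  have cheb: "chebyshev c m = 0" "chebyshev c (Suc m) = -1"
    using assms(4) by (simp_all add: c_def chebyshev_cos_pi_divide chebyshev_cos_pi_divide_Suc)
  then have cheb_n: "chebyshev c n = 1"
    by (simp add: n)
  have ab: "lorB a b = - c"
    using assms(3) by (simp add: c_def)
  show "word (alt_word a b m) a = (if even m then - a else - b)"
    using word_alt_word_first[OF assms(1,2) ab, of m] by (simp only: cheb) simp
  show "word (alt_word a b m) b = (if even m then - b else - a)"
    using word_alt_word_last[OF assms(1,2) ab, of n] cheb(1) cheb_n n by (simp del: alt_word.simps)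
qed

lemma lorB_plane_decomposition:
  assumes "lorB a a = 1" "lorB b b = 1" "(lorB a b)\<^sup>2 \<noteq> 1"
  obtains x y p where "v = x *\<^sub>R a + y *\<^sub>R b + p" "lorB a p = 0" "lorB b p = 0"
proof
  define g x y where "g = lorB a b"
    and "x = (lorB a v - g * lorB b v) / (1 - g\<^sup>2)"
    and "y = (lorB b v - g * lorB a v) / (1 - g\<^sup>2)"
  show "v = x *\<^sub>R a + y *\<^sub>R b + (v - x *\<^sub>R a - y *\<^sub>R b)"
    by simp
  have "1 - g\<^sup>2 \<noteq> 0"
    using assms(3) by (simp add: g_def)
  then have "x + g * y = lorB a v" "g * x + y = lorB b v"
    unfolding x_def y_def
    by (simp_all add: divide_simps) (simp_all add: algebra_simps power2_eq_square)
  then show "lorB a (v - x *\<^sub>R a - y *\<^sub>R b) = 0" "lorB b (v - x *\<^sub>R a - y *\<^sub>R b) = 0"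
    using assms(1,2) by (simp_all add: g_def lorB_commute[of b a] algebra_simps)
qed

lemma braid_relation:
  fixes a b :: "'a::euclidean_space \<times> real"
  assumes a: "lorB a a = 1" and b: "lorB b b = 1"
    and ab: "lorB a b = - cos (pi / real m)" and m: "m \<ge> 2"
  shows "word (alt_word a b m) = word (alt_word b a m)"
proof
  fix v
  have ba: "lorB b a = - cos (pi / real m)"
    using ab by (simp add: lorB_commute)
  have "(lorB a b)\<^sup>2 \<noteq> 1"
    using sin_pi_divide_nat_pos[OF m] by (simp add: ab cos_squared_eq)
  then obtain x y p where v: "v = x *\<^sub>R a + y *\<^sub>R b + p" and p: "lorB a p = 0" "lorB b p = 0"
    using lorB_plane_decomposition[OF a b] by blast
  have fixed: "word (alt_word a b m) p = p" "word (alt_word b a m) p = p"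
    using p set_alt_word[of a b m] set_alt_word[of b a m] by (auto intro!: word_orthogonal)
  have expand: "word xs v = x *\<^sub>R word xs a + y *\<^sub>R word xs b + word xs p" for xs
    using linear_word[of xs] by (simp add: v linear_add linear_scale)
  show "word (alt_word a b m) v = word (alt_word b a m) v"
    unfolding expand fixed
    using word_alt_word_cos_pi[OF a b ab m] word_alt_word_cos_pi[OF b a ba m] by simp
qed

definition coxeter_products :: "real set" where
  "coxeter_products = {..-1} \<union> {- cos (pi / real m) | m. m \<ge> (2::nat)}"

lemma coxeter_products_nonpos: "t \<in> coxeter_products \<Longrightarrow> t \<le> 0"
proof -
  have "cos (pi / real m) \<ge> 0" if "m \<ge> 2" for m :: nat
    using that by (intro cos_ge_zero) (auto simp: field_simps intro: order_trans[of _ 0])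
  then show "t \<in> coxeter_products \<Longrightarrow> t \<le> 0"
    by (auto simp: coxeter_products_def)
qed

lemma dihedral_length_increasing_word:
  assumes "lorB a a = 1" "lorB b b = 1" and u: "u \<in> coxeter_group {a, b}"
    and inc: "coxeter_length {a, b} u \<le> coxeter_length {a, b} (u \<circ> lor_refl a)"
  shows "u = word (alt_word a b (coxeter_length {a, b} u))"
proof -
  interpret unit_vectors "{a, b}"
    using assms by unfold_locales auto
  obtain xs where xs: "xs \<in> lists {a, b}" "word xs = u" "length xs = coxeter_length {a, b} u"
    using u by (rule reduced_wordE)
  have "last xs \<noteq> a" if nonempty: "xs \<noteq> []"
  proof
    assume "last xs = a"
    then obtain ys where ys: "xs = ys @ [a]"
      using nonempty by (cases xs rule: rev_cases) simp_all
    then have "u \<circ> lor_refl a = word ys"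
      using assms(1) by (simp add: xs(2)[symmetric] word_append comp_assoc lor_refl_comp_self)
    then have "coxeter_length {a, b} (u \<circ> lor_refl a) \<le> length ys"
      using xs(1) ys coxeter_length_word_le[of ys "{a, b}"] by simp
    with inc xs(3) ys show False
      by simp
  qed
  moreover have "distinct_adj xs" "set xs \<subseteq> {a, b}"
    using xs by (auto intro: reduced_word_distinct_adj simp: in_lists_conv_set)
  ultimately have "xs = alt_word a b (length xs)"
    by (intro distinct_adj_eq_alt_word)
  with xs show ?thesis
    by simp
qed

text \<open>An alternating word that contains one side of the braid relation can be rewritten so
  that it ends in \<open>a\<close>, and is therefore shortened by the reflection along \<open>a\<close>.\<close>
lemma dihedral_length_increasing_imp_less:
  assumes a: "lorB a a = 1" and b: "lorB b b = 1" and ab: "lorB a b = - cos (pi / real m)"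
    and m: "m \<ge> 2"
    and inc: "k \<le> coxeter_length {a, b} (word (alt_word a b k) \<circ> lor_refl a)"
  shows "k < m"
proof (rule ccontr)
  assume "\<not> k < m"
  then obtain j where j: "k = j + m"
    by (metis add.commute le_Suc_ex not_less)
  obtain n where n: "m = Suc n"
    using m by (cases m) auto
  define ys where "ys = take j (alt_word a b k)"
  have "alt_word a b k = ys @ alt_word a b m"
    using append_take_drop_id[of j "alt_word a b k"] by (simp add: ys_def j drop_alt_word)
  moreover have "word (alt_word a b m) = word (alt_word a b n) \<circ> lor_refl a"
    using braid_relation[OF a b ab m] unfolding n alt_word_snoc[of a b n, symmetric]
    by (simp only: word_append word_Cons word_Nil comp_id)
  ultimately have "word (alt_word a b k) \<circ> lor_refl a = word (ys @ alt_word a b n)"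
    using a by (simp add: word_append comp_assoc lor_refl_comp_self)
  moreover have "ys @ alt_word a b n \<in> lists {a, b}"
    using set_alt_word[of a b k] set_alt_word[of a b n]
    by (auto simp: ys_def in_lists_conv_set dest: in_set_takeD)
  ultimately have "k \<le> length (ys @ alt_word a b n)"
    using inc coxeter_length_word_le by (metis order_trans)
  then show False
    by (simp add: ys_def j n)
qed

lemma dihedral_length_increasing_imp_positive:
  assumes a: "lorB a a = 1" and b: "lorB b b = 1" and ab: "lorB a b \<in> coxeter_products"
    and u: "u \<in> coxeter_group {a, b}"
    and inc: "coxeter_length {a, b} u \<le> coxeter_length {a, b} (u \<circ> lor_refl a)"
  obtains x y where "x \<ge> 0" "y \<ge> 0" "u a = x *\<^sub>R a + y *\<^sub>R b"
proof -
  define k c where "k = coxeter_length {a, b} u" and "c = - lorB a b"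
  have u_alt: "u = word (alt_word a b k)"
    unfolding k_def using a b u inc by (intro dihedral_length_increasing_word)
  have inc_alt: "k \<le> coxeter_length {a, b} (word (alt_word a b k) \<circ> lor_refl a)"
    using inc by (simp flip: u_alt k_def)
  from ab consider "c \<ge> 1" | m :: nat where "m \<ge> 2" "c = cos (pi / real m)"
    by (auto simp: coxeter_products_def c_def)
  then have "chebyshev c k \<ge> 0 \<and> chebyshev c (Suc k) \<ge> 0"
  proof cases
    case 1
    then show ?thesis
      using chebyshev_nonneg_mono by blast
  next
    case (2 m)
    then have "k < m"
      using a b inc_alt
      by (intro dihedral_length_increasing_imp_less[of a b m]) (simp_all add: c_def)
    with 2 show ?thesis
      by (simp add: chebyshev_cos_pi_divide_nonneg)
  qed
  moreover have "u a = (if even k then chebyshev c (Suc k) *\<^sub>R a + chebyshev c k *\<^sub>R b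
      else chebyshev c k *\<^sub>R a + chebyshev c (Suc k) *\<^sub>R b)"
    unfolding u_alt using word_alt_word_first[OF a b, of c k] by (simp add: c_def add.commute)
  ultimately show ?thesis
    using that by (cases "even k") auto
qed

section \<open>Finite linear combinations\<close>

lemma span_finite_linear_bound:
  fixes v :: "'b::real_vector"
  assumes S: "finite S" "S \<noteq> {}" and v: "v \<in> span S"
  obtains C where "C > 0" "\<And>f :: 'b \<Rightarrow> real. linear f \<Longrightarrow> \<exists>s\<in>S. \<bar>f v\<bar> \<le> C * \<bar>f s\<bar>"
proof -
  obtain c where c: "v = (\<Sum>s\<in>S. c s *\<^sub>R s)"
    using v span_finite[OF S(1)] by auto
  define C where "C = 1 + (\<Sum>s\<in>S. \<bar>c s\<bar>)"
  have "\<exists>s\<in>S. \<bar>f v\<bar> \<le> C * \<bar>f s\<bar>" if f: "linear f" for f :: "'b \<Rightarrow> real"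
  proof -
    obtain s where s: "s \<in> S" "Max ((\<lambda>t. \<bar>f t\<bar>) ` S) = \<bar>f s\<bar>"
      using S by (rule obtains_MAX)
    have "\<bar>f v\<bar> = \<bar>\<Sum>t\<in>S. c t * f t\<bar>"
      using f by (simp add: c linear_sum linear_scale)
    also have "\<dots> \<le> (\<Sum>t\<in>S. \<bar>c t\<bar> * \<bar>f t\<bar>)"
      by (rule order_trans[OF sum_abs]) (simp add: abs_mult)
    also have "\<dots> \<le> (\<Sum>t\<in>S. \<bar>c t\<bar> * \<bar>f s\<bar>)"
      using S(1) s(2) by (intro sum_mono mult_left_mono) (simp_all flip: s(2))
    also have "\<dots> \<le> C * \<bar>f s\<bar>"
      by (simp add: C_def algebra_simps flip: sum_distrib_right)
    finally show ?thesis
      using s(1) by blast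
  qed
  moreover have "C > 0"
    by (simp add: C_def add_pos_nonneg sum_nonneg)
  ultimately show ?thesis
    using that by blast
qed

lemma pos_cone_base:
  assumes "finite D" "\<alpha> \<in> D"
  shows "\<alpha> \<in> pos_cone D"
proof -
  have "(\<Sum>\<beta>\<in>D. (if \<beta> = \<alpha> then 1 else 0) *\<^sub>R \<beta>) = \<alpha>"
    using assms by (simp add: if_distrib[of "\<lambda>c. c *\<^sub>R _"] cong: if_cong)
  then show ?thesis
    unfolding pos_cone_def by (intro CollectI exI[of _ "\<lambda>\<beta>. if \<beta> = \<alpha> then 1 else 0"]) auto
qed

lemma pos_cone_combination:
  assumes "u \<in> pos_cone D" "v \<in> pos_cone D" "a \<ge> 0" "b \<ge> 0"
  shows "a *\<^sub>R u + b *\<^sub>R v \<in> pos_cone D"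
proof -
  obtain f g where f: "u = (\<Sum>\<alpha>\<in>D. f \<alpha> *\<^sub>R \<alpha>)" "\<forall>\<alpha>\<in>D. f \<alpha> \<ge> 0"
    and g: "v = (\<Sum>\<alpha>\<in>D. g \<alpha> *\<^sub>R \<alpha>)" "\<forall>\<alpha>\<in>D. g \<alpha> \<ge> 0"
    using assms by (auto simp: pos_cone_def)
  have "a *\<^sub>R u + b *\<^sub>R v = (\<Sum>\<alpha>\<in>D. (a * f \<alpha> + b * g \<alpha>) *\<^sub>R \<alpha>)"
    by (simp add: f(1) g(1) scaleR_sum_right sum.distrib scaleR_add_left)
  then show ?thesis
    unfolding pos_cone_def using f g assms
    by (intro CollectI exI[of _ "\<lambda>\<alpha>. a * f \<alpha> + b * g \<alpha>"]) auto
qed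

lemma coefficient_sum_ge_1:
  assumes nonneg: "\<And>\<alpha>. \<alpha> \<in> D \<Longrightarrow> c \<alpha> \<ge> 0"
    and B: "\<And>\<alpha> \<beta>. \<alpha> \<in> D \<Longrightarrow> \<beta> \<in> D \<Longrightarrow> lorB \<alpha> \<beta> \<le> 1"
    and q: "lorq (\<Sum>\<alpha>\<in>D. c \<alpha> *\<^sub>R \<alpha>) = 1"
  shows "1 \<le> (\<Sum>\<alpha>\<in>D. c \<alpha>)"
proof -
  define v where "v = (\<Sum>\<alpha>\<in>D. c \<alpha> *\<^sub>R \<alpha>)"
  have expand: "lorB x v = (\<Sum>\<beta>\<in>D. c \<beta> * lorB x \<beta>)" for x
    by (simp add: v_def linear_sum[OF linear_lorB])
  have "1 = (\<Sum>\<alpha>\<in>D. c \<alpha> * lorB v \<alpha>)"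
    using q expand[of v] by (simp add: lorq_def v_def)
  also have "\<dots> = (\<Sum>\<alpha>\<in>D. c \<alpha> * (\<Sum>\<beta>\<in>D. c \<beta> * lorB \<alpha> \<beta>))"
    by (simp add: lorB_commute[of v] expand)
  also have "\<dots> \<le> (\<Sum>\<alpha>\<in>D. c \<alpha> * (\<Sum>\<beta>\<in>D. c \<beta>))"
    using nonneg B by (intro sum_mono mult_left_mono mult_left_le) auto
  also have "\<dots> = (\<Sum>\<alpha>\<in>D. c \<alpha>)\<^sup>2"
    by (simp add: sum_distrib_right power2_eq_square)
  finally show ?thesis
    using nonneg by (metis one_power2 power2_le_imp_le sum_nonneg)
qed

section \<open>Positivity\<close>

locale future_simple_system =
  fixes \<Delta> :: "('a::euclidean_space \<times> real) set"
  assumes simple: "simple_system \<Delta>"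
    and snd_pos: "\<alpha> \<in> \<Delta> \<Longrightarrow> snd \<alpha> > 0"
begin

abbreviation "W \<equiv> coxeter_group \<Delta>"

sublocale unit_vectors \<Delta>
  using simple by unfold_locales (simp add: simple_system_def)

lemma finite_simple: "finite \<Delta>"
  using simple by (simp add: simple_system_def)

lemma lorB_simple_coxeter_products: "\<alpha> \<in> \<Delta> \<Longrightarrow> \<beta> \<in> \<Delta> \<Longrightarrow> \<alpha> \<noteq> \<beta> \<Longrightarrow> lorB \<alpha> \<beta> \<in> coxeter_products"
  using simple by (auto simp: simple_system_def coxeter_products_def)

lemma lorB_simple_le_1: "\<alpha> \<in> \<Delta> \<Longrightarrow> \<beta> \<in> \<Delta> \<Longrightarrow> lorB \<alpha> \<beta> \<le> 1"
  using lorB_simple_coxeter_products[of \<alpha> \<beta>] coxeter_products_nonpos[of "lorB \<alpha> \<beta>"] lorB_self[of \<alpha>]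
  by (cases "\<alpha> = \<beta>") auto

text \<open>Factor \<open>w = v u\<close> through the dihedral group generated by \<open>\<alpha>\<close> and a simple root \<open>\<beta>\<close>
  whose reflection shortens \<open>w\<close>, with \<open>v\<close> shortest possible.  By induction \<open>v\<close> maps \<open>\<alpha>\<close> and \<open>\<beta>\<close>
  into the cone, and the dihedral case applies to \<open>u\<close>.\<close>
lemma length_increasing_imp_positive:
  assumes "w \<in> W" "\<alpha> \<in> \<Delta>" "coxeter_length \<Delta> w \<le> coxeter_length \<Delta> (w \<circ> lor_refl \<alpha>)"
  shows "w \<alpha> \<in> pos_cone \<Delta>"
  using assms
proof (induction "coxeter_length \<Delta> w" arbitrary: w \<alpha> rule: less_induct)
  case less
  note w = less.prems(1) and \<alpha> = less.prems(2) and inc = less.prems(3)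
  show ?case
  proof (cases "w = id")
    case True
    then show ?thesis
      using pos_cone_base[OF finite_simple \<alpha>] by simp
  next
    case False
    with w obtain \<beta> where \<beta>: "\<beta> \<in> \<Delta>"
      "coxeter_length \<Delta> (w \<circ> lor_refl \<beta>) < coxeter_length \<Delta> w"
      by (rule descentE)
    with inc have "\<alpha> \<noteq> \<beta>"
      by auto
    have sub: "{\<alpha>, \<beta>} \<subseteq> \<Delta>"
      using \<alpha> \<beta>(1) by simp
    with w obtain v u where v: "v \<in> W" and u: "u \<in> coxeter_group {\<alpha>, \<beta>}" and vu: "w = v \<circ> u"
      and len: "coxeter_length \<Delta> v + coxeter_length {\<alpha>, \<beta>} u = coxeter_length \<Delta> w"
      and v_inc: "\<And>\<gamma>. \<gamma> \<in> {\<alpha>, \<beta>} \<Longrightarrow> coxeter_length \<Delta> v \<le> coxeter_length \<Delta> (v \<circ> lor_refl \<gamma>)"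
      by (rule parabolic_factorization) blast
    have "u \<noteq> id"
      using \<beta>(2) vu v_inc[of \<beta>] by auto
    then have "coxeter_length \<Delta> v < coxeter_length \<Delta> w"
      using len coxeter_length_eq_0_iff[OF u] by linarith
    then have positive: "v \<alpha> \<in> pos_cone \<Delta>" "v \<beta> \<in> pos_cone \<Delta>"
      using less.hyps v \<alpha> \<beta>(1) v_inc by simp_all
    have "coxeter_length {\<alpha>, \<beta>} u \<le> coxeter_length {\<alpha>, \<beta>} (u \<circ> lor_refl \<alpha>)"
      using len inc parabolic_factor_length_increasing[OF v u sub, of \<alpha>] by (simp add: vu)
    then obtain x y where "x \<ge> 0" "y \<ge> 0" "u \<alpha> = x *\<^sub>R \<alpha> + y *\<^sub>R \<beta>"
      using dihedral_length_increasing_imp_positive[OF _ _ _ u] \<alpha> \<beta>(1) \<open>\<alpha> \<noteq> \<beta>\<close>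
      by (metis lorB_self lorB_simple_coxeter_products)
    with positive show ?thesis
      using linear_coxeter_group[OF v]
      by (simp add: vu linear_add linear_scale pos_cone_combination)
  qed
qed

corollary exists_negative_image:
  assumes "w \<in> W" "w \<noteq> id"
  obtains \<alpha> where "\<alpha> \<in> \<Delta>" "- w \<alpha> \<in> pos_cone \<Delta>"
proof -
  obtain \<alpha> where \<alpha>: "\<alpha> \<in> \<Delta>" "coxeter_length \<Delta> (w \<circ> lor_refl \<alpha>) < coxeter_length \<Delta> w"
    using assms by (rule descentE)
  have "(w \<circ> lor_refl \<alpha>) \<alpha> \<in> pos_cone \<Delta>"
  proof (rule length_increasing_imp_positive[of "w \<circ> lor_refl \<alpha>" \<alpha>])
    show "w \<circ> lor_refl \<alpha> \<in> W"
      using assms(1) \<alpha>(1) by (intro comp_in_coxeter_group lor_refl_in_coxeter_group)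
    show "coxeter_length \<Delta> (w \<circ> lor_refl \<alpha>) \<le> coxeter_length \<Delta> (w \<circ> lor_refl \<alpha> \<circ> lor_refl \<alpha>)"
      using \<alpha> by (simp add: comp_assoc lor_refl_comp_self lorB_self)
  qed (rule \<alpha>(1))
  moreover have "(w \<circ> lor_refl \<alpha>) \<alpha> = - w \<alpha>"
    using \<alpha>(1) linear_coxeter_group[OF assms(1)] by (simp add: lor_refl_self lorB_self linear_neg)
  ultimately show ?thesis
    using that \<alpha>(1) by simp
qed

section \<open>Discreteness of the orbit of the base point\<close>

lemma snd_unit_positive_ge:
  obtains \<epsilon> where "\<epsilon> > 0" "\<And>\<beta>. \<beta> \<in> pos_cone \<Delta> \<Longrightarrow> lorq \<beta> = 1 \<Longrightarrow> snd \<beta> \<ge> \<epsilon>"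
proof
  define \<epsilon> where "\<epsilon> = Min (insert 1 (snd ` \<Delta>))"
  show "\<epsilon> > 0"
    using finite_simple snd_pos by (auto simp: \<epsilon>_def)
  have \<epsilon>: "\<epsilon> \<le> snd \<alpha>" if "\<alpha> \<in> \<Delta>" for \<alpha>
    using finite_simple that by (simp add: \<epsilon>_def)
  fix \<beta> :: "'a \<times> real" assume "\<beta> \<in> pos_cone \<Delta>" and q: "lorq \<beta> = 1"
  then obtain c where c: "\<beta> = (\<Sum>\<alpha>\<in>\<Delta>. c \<alpha> *\<^sub>R \<alpha>)" "\<forall>\<alpha>\<in>\<Delta>. c \<alpha> \<ge> 0"
    by (auto simp: pos_cone_def)
  have "1 \<le> (\<Sum>\<alpha>\<in>\<Delta>. c \<alpha>)"
    using q c lorB_simple_le_1 by (intro coefficient_sum_ge_1) auto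
  then have "\<epsilon> \<le> (\<Sum>\<alpha>\<in>\<Delta>. c \<alpha>) * \<epsilon>"
    using \<open>\<epsilon> > 0\<close> by simp
  also have "\<dots> \<le> (\<Sum>\<alpha>\<in>\<Delta>. c \<alpha> * snd \<alpha>)"
    using \<epsilon> c(2) by (auto simp: sum_distrib_right intro!: sum_mono mult_left_mono)
  also have "\<dots> = snd \<beta>"
    by (simp add: c(1) snd_sum)
  finally show "\<epsilon> \<le> snd \<beta>" .
qed

lemma snd_inv_e_last: "w \<in> W \<Longrightarrow> snd (inv w e_last) = snd (w e_last)"
  using lorB_inv_coxeter_group[of w e_last e_last] by simp

text \<open>Some \<open>w \<alpha>\<close> is negative, so the hyperplane orthogonal to \<open>\<alpha>\<close> separates the base point from
  its image under the inverse of \<open>w\<close>, and this image stays away from the hyperplane.\<close>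
lemma norm_fst_inv_e_last_ge:
  obtains d where "d > 0" "\<And>w. w \<in> W \<Longrightarrow> w \<noteq> id \<Longrightarrow> norm (fst (inv w e_last)) \<ge> d"
proof -
  obtain \<epsilon> where \<epsilon>: "\<epsilon> > 0" "\<And>\<beta>. \<beta> \<in> pos_cone \<Delta> \<Longrightarrow> lorq \<beta> = 1 \<Longrightarrow> snd \<beta> \<ge> \<epsilon>"
    using snd_unit_positive_ge by blast
  define K where "K = 1 + (\<Sum>\<alpha>\<in>\<Delta>. norm (fst \<alpha>))"
  have K: "K > 0"
    by (simp add: K_def add_pos_nonneg sum_nonneg)
  have "\<epsilon> / K \<le> norm (fst (inv w e_last))" if w: "w \<in> W" "w \<noteq> id" for w
  proof -
    define y where "y = inv w e_last"
    obtain \<alpha> where \<alpha>: "\<alpha> \<in> \<Delta>" "- w \<alpha> \<in> pos_cone \<Delta>"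
      using exists_negative_image[OF w] .
    have "lorq (- w \<alpha>) = 1"
      using w \<alpha> by (simp add: lorq_def lorB_coxeter_group lorB_self)
    then have "\<epsilon> \<le> snd (- w \<alpha>)"
      using \<epsilon>(2) \<alpha>(2) by blast
    also have "\<dots> = lorB y \<alpha>"
      using w by (simp add: y_def lorB_inv_coxeter_group)
    also have "\<dots> \<le> fst y \<bullet> fst \<alpha>"
    proof -
      have "snd y > 0"
        using w coxeter_group_future_cone[OF w(1) e_last_in_future_cone]
        by (simp add: y_def snd_inv_e_last future_cone_iff)
      with snd_pos[OF \<alpha>(1)] show ?thesis
        by (simp add: lorB_def)
    qed
    also have "\<dots> \<le> norm (fst y) * norm (fst \<alpha>)"
      by (rule norm_cauchy_schwarz)
    also have "\<dots> \<le> norm (fst y) * K"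
      using member_le_sum[OF \<alpha>(1), of "\<lambda>\<alpha>. norm (fst \<alpha>)"] finite_simple
      by (intro mult_left_mono) (simp_all add: K_def)
    finally show ?thesis
      using K by (simp add: y_def field_simps)
  qed
  then show ?thesis
    using that[of "\<epsilon> / K"] \<epsilon>(1) K by simp
qed

lemma snd_orbit_gap:
  obtains r where "r > 1" "\<And>w. w \<in> W \<Longrightarrow> w \<noteq> id \<Longrightarrow> snd (w e_last) \<ge> r"
proof -
  obtain d where d: "d > 0" "\<And>w. w \<in> W \<Longrightarrow> w \<noteq> id \<Longrightarrow> norm (fst (inv w e_last)) \<ge> d"
    using norm_fst_inv_e_last_ge by blast
  have "sqrt (1 + d\<^sup>2) \<le> snd (w e_last)" if w: "w \<in> W" "w \<noteq> id" for w
  proof (rule real_le_lsqrt)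
    have "lorq (inv w e_last) = -1"
      using w by (simp add: lorq_coxeter_group inv_in_coxeter_group)
    then have "(snd (w e_last))\<^sup>2 = 1 + (norm (fst (inv w e_last)))\<^sup>2"
      using w by (simp add: lorq_eq snd_inv_e_last)
    then show "1 + d\<^sup>2 \<le> (snd (w e_last))\<^sup>2"
      using d w power_mono[of d "norm (fst (inv w e_last))" 2] by simp
    show "0 \<le> snd (w e_last)"
      using coxeter_group_future_cone[OF w(1) e_last_in_future_cone] by (simp add: future_cone_iff)
  qed
  then show ?thesis
    using that[of "sqrt (1 + d\<^sup>2)"] d(1) by simp
qed

lemma orbit_separated:
  obtains d where "d > 0"
    "\<And>v w. v \<in> W \<Longrightarrow> w \<in> W \<Longrightarrow> v \<noteq> w \<Longrightarrow> dist (v e_last) (w e_last) \<ge> d"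
proof -
  obtain r where r: "r > 1" "\<And>w. w \<in> W \<Longrightarrow> w \<noteq> id \<Longrightarrow> snd (w e_last) \<ge> r"
    using snd_orbit_gap by blast
  have "sqrt (2 * (r - 1)) \<le> dist (v e_last) (w e_last)" if vw: "v \<in> W" "w \<in> W" "v \<noteq> w" for v w
  proof -
    have "inv v \<circ> w \<noteq> id"
    proof
      assume "inv v \<circ> w = id"
      then have "v x = w x" for x
        using vw(1) coxeter_group_apply_inv[of v "w x"] by (metis comp_apply id_apply)
      with vw(3) show False by auto
    qed
    then have "r \<le> snd ((inv v \<circ> w) e_last)"
      using vw by (intro r(2) comp_in_coxeter_group inv_in_coxeter_group)
    also have "\<dots> = - lorB (inv v (w e_last)) e_last"
      by simp
    also have "\<dots> = - lorB (v e_last) (w e_last)"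
      unfolding lorB_inv_coxeter_group[OF vw(1)] by (simp only: lorB_commute)
    finally have "2 * (r - 1) \<le> lorq (v e_last - w e_last)"
      using vw by (simp add: lorq_diff lorq_coxeter_group)
    also have "\<dots> \<le> (dist (v e_last) (w e_last))\<^sup>2"
      unfolding dist_norm by (rule lorq_le_norm)
    finally show ?thesis
      by (simp add: real_le_lsqrt)
  qed
  then show ?thesis
    using that[of "sqrt (2 * (r - 1))"] r(1) by simp
qed

lemma finite_coxeter_group_snd_le: "finite {w \<in> W. snd (w e_last) \<le> M}"
proof -
  define A where "A = {w \<in> W. snd (w e_last) \<le> M}"
  obtain d where d: "d > 0"
    "\<And>v w. v \<in> W \<Longrightarrow> w \<in> W \<Longrightarrow> v \<noteq> w \<Longrightarrow> dist (v e_last) (w e_last) \<ge> d"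
    using orbit_separated by blast
  have "uniform_discrete ((\<lambda>w. w e_last) ` A)"
    unfolding uniform_discrete_def using d by (fastforce simp: A_def)
  moreover have "bounded ((\<lambda>w. w e_last) ` A)"
    unfolding bounded_iff
  proof (intro exI ballI)
    fix y assume "y \<in> (\<lambda>w. w e_last) ` A"
    then have "y \<in> future_cone" "snd y \<le> M"
      using coxeter_group_future_cone[OF _ e_last_in_future_cone] by (auto simp: A_def)
    then show "norm y \<le> M + M"
      using norm_Pair_le[of "fst y" "snd y"] future_cone_iff[of y] by (simp add: future_cone_def)
  qed
  ultimately have "finite ((\<lambda>w. w e_last) ` A)"
    using uniform_discrete_finite_iff by blast
  moreover have "inj_on (\<lambda>w. w e_last) A"
    using d by (force simp: inj_on_def A_def)
  ultimately show ?thesis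
    unfolding A_def by (rule finite_imageD)
qed

lemma finite_root_directions:
  "finite (hat ` {\<beta> \<in> root_system \<Delta>. snd \<beta> \<noteq> 0 \<and> \<bar>snd \<beta>\<bar> \<le> M})"
proof (rule finite_subset)
  show "hat ` {\<beta> \<in> root_system \<Delta>. snd \<beta> \<noteq> 0 \<and> \<bar>snd \<beta>\<bar> \<le> M}
    \<subseteq> (\<lambda>w. hat (w e_last - e_last)) ` {w \<in> W. snd (w e_last) \<le> 1 + 2 * M\<^sup>2}"
  proof (rule image_subsetI)
    fix \<beta> assume "\<beta> \<in> {\<beta> \<in> root_system \<Delta>. snd \<beta> \<noteq> 0 \<and> \<bar>snd \<beta>\<bar> \<le> M}"
    then have \<beta>: "\<beta> \<in> root_system \<Delta>" "snd \<beta> \<noteq> 0" "\<bar>snd \<beta>\<bar> \<le> M" by simp_all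
    have "hat \<beta> = hat (lor_refl \<beta> e_last - e_last)"
      using \<beta>(2) by (simp add: lor_refl_e_last hat_def)
    moreover have "snd (lor_refl \<beta> e_last) \<le> 1 + 2 * M\<^sup>2"
      using power_mono[OF \<beta>(3), of 2] by (simp add: snd_lor_refl_e_last)
    ultimately show "hat \<beta> \<in> (\<lambda>w. hat (w e_last - e_last)) ` {w \<in> W. snd (w e_last) \<le> 1 + 2 * M\<^sup>2}"
      using lor_refl_root_in_coxeter_group[OF \<beta>(1)] by blast
  qed
qed (simp add: finite_coxeter_group_snd_le)

section \<open>Limit points of orbits and limit roots\<close>

lemma orbit_limit_points_eq: "orbit_limit_points \<Delta> x = {z. z islimpt (\<lambda>w. hat (w x)) ` W}"
  unfolding orbit_limit_points_def by (simp add: Setcompr_eq_image)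

lemma limit_roots_eq:
  "limit_roots \<Delta> = {z. z islimpt hat ` {\<beta> \<in> root_system \<Delta>. snd \<beta> \<noteq> 0}}"
proof -
  have "{hat \<beta> | \<beta>. \<beta> \<in> root_system \<Delta> \<and> snd \<beta> \<noteq> 0} = hat ` {\<beta> \<in> root_system \<Delta>. snd \<beta> \<noteq> 0}"
    by blast
  then show ?thesis unfolding limit_roots_def by simp
qed

lemma orbit_limit_pointE:
  assumes "z \<in> orbit_limit_points \<Delta> x"
  obtains F where "F \<noteq> bot" "\<forall>\<^sub>F w in F. w \<in> W" "((\<lambda>w. hat (w x)) \<longlongrightarrow> z) F"
    "filterlim (\<lambda>w. snd (w e_last)) at_top F"
proof (rule islimpt_image_filter)
  show "z islimpt (\<lambda>w. hat (w x)) ` W"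
    using assms by (simp add: orbit_limit_points_eq)
  show "finite ((\<lambda>w. hat (w x)) ` {w \<in> W. snd (w e_last) \<le> M})" for M
    by (intro finite_imageI finite_coxeter_group_snd_le)
qed (rule that)

lemma snd_orbit_ge:
  assumes "w \<in> W"
  shows "(snd x - norm (fst x)) * snd (w e_last) \<le> snd (w x)"
proof -
  have "inv w e_last \<in> future_cone"
    using assms by (simp add: coxeter_group_future_cone inv_in_coxeter_group e_last_in_future_cone)
  then have "(snd x - norm (fst x)) * snd (inv w e_last) \<le> - lorB x (inv w e_last)"
    by (rule minus_lorB_ge)
  with assms show ?thesis
    by (simp add: snd_inv_e_last lorB_commute[of x] lorB_inv_coxeter_group)
qed

lemma filterlim_snd_orbit:
  assumes x: "x \<in> future_cone" and F: "\<forall>\<^sub>F w in F. w \<in> W"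
    and escape: "filterlim (\<lambda>w. snd (w e_last)) at_top F"
  shows "filterlim (\<lambda>w. snd (w x)) at_infinity F"
proof (rule filterlim_at_top_imp_at_infinity, rule filterlim_at_top_mono)
  show "filterlim (\<lambda>w. (snd x - norm (fst x)) * snd (w e_last)) at_top F"
    using x by (intro filterlim_tendsto_pos_mult_at_top[OF tendsto_const _ escape])
      (simp add: future_cone_def)
  show "\<forall>\<^sub>F w in F. (snd x - norm (fst x)) * snd (w e_last) \<le> snd (w x)"
    using F by eventually_elim (rule snd_orbit_ge)
qed

lemma Bfun_lorB_orbit:
  assumes "\<forall>\<^sub>F w in F. w \<in> W" "finite S" "\<And>w. w \<in> W \<Longrightarrow> r w \<in> S"
  shows "Bfun (\<lambda>w. lorB (w (r w)) (w v)) F"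
proof (rule BfunI)
  have "norm (lorB (w (r w)) (w v)) \<le> (\<Sum>u\<in>S. \<bar>lorB u v\<bar>)" if "w \<in> W" for w
    using assms(2) assms(3)[OF that] member_le_sum[of "r w" S "\<lambda>u. \<bar>lorB u v\<bar>"]
    by (simp add: lorB_coxeter_group that)
  with assms(1) show "\<forall>\<^sub>F w in F. norm (lorB (w (r w)) (w v)) \<le> (\<Sum>u\<in>S. \<bar>lorB u v\<bar>)"
    by (rule eventually_mono)
qed

lemma orbit_limit_points_subset:
  assumes x: "x \<in> future_cone" and y: "y \<in> future_cone"
  shows "orbit_limit_points \<Delta> x \<subseteq> orbit_limit_points \<Delta> y"
proof
  fix z assume "z \<in> orbit_limit_points \<Delta> x"
  then obtain F where F: "F \<noteq> bot" "\<forall>\<^sub>F w in F. w \<in> W" "((\<lambda>w. hat (w x)) \<longlongrightarrow> z) F"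
    and escape: "filterlim (\<lambda>w. snd (w e_last)) at_top F"
    by (rule orbit_limit_pointE)
  have bounded: "Bfun (\<lambda>w. lorB (w u) (w v)) F" for u v
    by (rule Bfun_lorB_orbit[OF F(2), of "{u}"]) simp_all
  have "z islimpt (\<lambda>w. hat (w y)) ` W"
  proof (rule islimpt_hat_transfer[OF F(1,3)])
    show y_escape: "filterlim (\<lambda>w. snd (w y)) at_infinity F"
      and x_escape: "filterlim (\<lambda>w. snd (w x)) at_infinity F"
      using x y F(2) escape by (simp_all add: filterlim_snd_orbit)
    show "Bfun (\<lambda>w. lorq (w y)) F" "Bfun (\<lambda>w. lorq (w x)) F"
      unfolding lorq_def by (rule bounded)+
    show "((\<lambda>w. lorB (hat (w y)) (hat (w x))) \<longlongrightarrow> 0) F"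
      using bounded y_escape x_escape by (rule lorB_hat_tendsto_0)
    show "\<forall>\<^sub>F w in F. hat (w y) \<in> (\<lambda>w. hat (w y)) ` W \<and> lorq (w y) \<noteq> 0"
      using F(2) by eventually_elim (use y in \<open>simp add: lorq_coxeter_group future_cone_iff\<close>)
  qed
  then show "z \<in> orbit_limit_points \<Delta> y"
    by (simp add: orbit_limit_points_eq)
qed

lemma limit_roots_subset_orbit_limit_points:
  "limit_roots \<Delta> \<subseteq> orbit_limit_points \<Delta> e_last"
proof
  let ?A = "{\<beta> \<in> root_system \<Delta>. snd \<beta> \<noteq> 0}"
  fix z assume "z \<in> limit_roots \<Delta>"
  then obtain F where F: "F \<noteq> bot" "\<forall>\<^sub>F \<beta> in F. \<beta> \<in> ?A" "(hat \<longlongrightarrow> z) F"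
    and escape: "filterlim (\<lambda>\<beta>. \<bar>snd \<beta>\<bar>) at_top F"
    using islimpt_image_filter[of z hat ?A "\<lambda>\<beta>. \<bar>snd \<beta>\<bar>"] finite_root_directions
    by (auto simp: limit_roots_eq conj_assoc)
  have refl: "\<forall>\<^sub>F \<beta> in F. lor_refl \<beta> \<in> W \<and> lorq \<beta> = 1 \<and> snd \<beta> \<noteq> 0"
    using F(2) by eventually_elim (simp add: lor_refl_root_in_coxeter_group lorq_root)
  have "z islimpt (\<lambda>w. hat (w e_last)) ` W"
  proof (rule islimpt_hat_transfer[OF F(1,3)])
    have "filterlim (\<lambda>\<beta>. 1 + 2 * \<bar>snd \<beta>\<bar>\<^sup>2) at_top F"
      by (intro filterlim_tendsto_add_at_top[OF tendsto_const]
          filterlim_tendsto_pos_mult_at_top[OF tendsto_const] filterlim_pow_at_top escape) auto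
    then show refl_escape: "filterlim (\<lambda>\<beta>. snd (lor_refl \<beta> e_last)) at_infinity F"
      by (simp add: snd_lor_refl_e_last filterlim_at_top_imp_at_infinity)
    show "filterlim snd at_infinity F"
      using escape by (intro filterlim_norm_at_top_imp_at_infinity) simp
    show "Bfun (\<lambda>\<beta>. lorq (lor_refl \<beta> e_last)) F" "Bfun lorq F"
      using refl by (intro BfunI[where K = 1], eventually_elim, simp add: lorq_coxeter_group)+
    have "((\<lambda>\<beta>. 1 / snd (lor_refl \<beta> e_last)) \<longlongrightarrow> 0) F"
      by (rule tendsto_divide_0[OF tendsto_const refl_escape])
    moreover have "\<forall>\<^sub>F \<beta> in F. 1 / snd (lor_refl \<beta> e_last) = lorB (hat (lor_refl \<beta> e_last)) (hat \<beta>)"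
      using refl by eventually_elim (simp add: lorB_hat lor_refl_e_last lorq_def)
    ultimately show "((\<lambda>\<beta>. lorB (hat (lor_refl \<beta> e_last)) (hat \<beta>)) \<longlongrightarrow> 0) F"
      by (rule Lim_transform_eventually)
    show "\<forall>\<^sub>F \<beta> in F. hat (lor_refl \<beta> e_last) \<in> (\<lambda>w. hat (w e_last)) ` W
        \<and> lorq (lor_refl \<beta> e_last) \<noteq> 0"
      using refl by eventually_elim (simp add: lorq_coxeter_group)
  qed
  then show "z \<in> orbit_limit_points \<Delta> e_last"
    by (simp add: orbit_limit_points_eq)
qed

lemma snd_orbit_le_simple_image:
  assumes "span \<Delta> = UNIV"
  obtains C where "C > 0" "\<And>w. w \<in> W \<Longrightarrow> \<exists>\<alpha>\<in>\<Delta>. \<bar>snd (w e_last)\<bar> \<le> C * \<bar>snd (w \<alpha>)\<bar>"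
proof -
  have "\<Delta> \<noteq> {}"
  proof
    assume "\<Delta> = {}"
    then have "e_last \<in> {0 :: 'a \<times> real}"
      using assms by simp
    then show False by (simp add: e_last_def zero_prod_def)
  qed
  moreover have "e_last \<in> span \<Delta>"
    using assms by simp
  ultimately obtain C where C: "C > 0"
    "\<And>f :: 'a \<times> real \<Rightarrow> real. linear f \<Longrightarrow> \<exists>\<alpha>\<in>\<Delta>. \<bar>f e_last\<bar> \<le> C * \<bar>f \<alpha>\<bar>"
    using span_finite_linear_bound[OF finite_simple] by blast
  have "linear (\<lambda>v. snd (w v))" if "w \<in> W" for w
    using linear_compose[OF linear_coxeter_group[OF that] linear_snd] by (simp add: comp_def)
  with C show ?thesis
    using that by blast
qed

lemma simple_images_escape:
  assumes "span \<Delta> = UNIV" and F: "\<forall>\<^sub>F w in F. w \<in> W"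
    and escape: "filterlim (\<lambda>w. snd (w e_last)) at_top F"
  obtains r where "\<And>w. w \<in> W \<Longrightarrow> r w \<in> \<Delta>" "filterlim (\<lambda>w. snd (w (r w))) at_infinity F"
proof -
  obtain C where C: "C > 0"
    and ex: "\<And>w. w \<in> W \<Longrightarrow> \<exists>\<alpha>\<in>\<Delta>. \<bar>snd (w e_last)\<bar> \<le> C * \<bar>snd (w \<alpha>)\<bar>"
    using snd_orbit_le_simple_image[OF assms(1)] by blast
  from ex obtain r where r: "\<And>w. w \<in> W \<Longrightarrow> r w \<in> \<Delta>"
    and large: "\<And>w. w \<in> W \<Longrightarrow> \<bar>snd (w e_last)\<bar> \<le> C * \<bar>snd (w (r w))\<bar>"
    by metis
  have "filterlim (\<lambda>w. snd (w (r w))) at_infinity F"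
  proof (rule filterlim_norm_at_top_imp_at_infinity, rule filterlim_at_top_mono)
    show "filterlim (\<lambda>w. 1 / C * snd (w e_last)) at_top F"
      using C by (intro filterlim_tendsto_pos_mult_at_top[OF tendsto_const _ escape]) simp
    show "\<forall>\<^sub>F w in F. 1 / C * snd (w e_last) \<le> norm (snd (w (r w)))"
      using F by eventually_elim (use large C in \<open>force simp: field_simps\<close>)
  qed
  with r show ?thesis
    using that by blast
qed

lemma orbit_limit_points_subset_limit_roots:
  assumes "span \<Delta> = UNIV"
  shows "orbit_limit_points \<Delta> e_last \<subseteq> limit_roots \<Delta>"
proof
  fix z assume "z \<in> orbit_limit_points \<Delta> e_last"
  then obtain F where F: "F \<noteq> bot" "\<forall>\<^sub>F w in F. w \<in> W" "((\<lambda>w. hat (w e_last)) \<longlongrightarrow> z) F"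
    and escape: "filterlim (\<lambda>w. snd (w e_last)) at_top F"
    by (rule orbit_limit_pointE)
  obtain r where r: "\<And>w. w \<in> W \<Longrightarrow> r w \<in> \<Delta>"
    and r_escape: "filterlim (\<lambda>w. snd (w (r w))) at_infinity F"
    using simple_images_escape[OF assms F(2) escape] by blast
  have root: "w (r w) \<in> root_system \<Delta>" if "w \<in> W" for w
    using r[OF that] that unfolding root_system_def by blast
  have "z islimpt hat ` {\<beta> \<in> root_system \<Delta>. snd \<beta> \<noteq> 0}"
  proof (rule islimpt_hat_transfer[OF F(1,3)])
    show "filterlim (\<lambda>w. snd (w (r w))) at_infinity F"
      by (rule r_escape)
    show e_escape: "filterlim (\<lambda>w. snd (w e_last)) at_infinity F"
      using escape by (rule filterlim_at_top_imp_at_infinity)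
    show "Bfun (\<lambda>w. lorq (w (r w))) F" "Bfun (\<lambda>w. lorq (w e_last)) F"
      using F(2)
      by (intro BfunI[where K = 1], eventually_elim, simp add: root lorq_root lorq_coxeter_group)+
    have "Bfun (\<lambda>w. lorB (w (r w)) (w e_last)) F"
      using F(2) finite_simple r by (rule Bfun_lorB_orbit)
    then show "((\<lambda>w. lorB (hat (w (r w))) (hat (w e_last))) \<longlongrightarrow> 0) F"
      using r_escape e_escape by (rule lorB_hat_tendsto_0)
    have "\<forall>\<^sub>F w in F. snd (w (r w)) \<noteq> 0"
      using r_escape by (simp add: filterlim_at_infinity_imp_eventually_ne)
    with F(2) show "\<forall>\<^sub>F w in F. hat (w (r w)) \<in> hat ` {\<beta> \<in> root_system \<Delta>. snd \<beta> \<noteq> 0}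
        \<and> lorq (w (r w)) \<noteq> 0"
      by eventually_elim (simp add: root lorq_root)
  qed
  then show "z \<in> limit_roots \<Delta>"
    by (simp add: limit_roots_eq)
qed

end

theorem theorem3p3:
  fixes \<Delta> :: "('a::euclidean_space \<times> real) set" and x0 :: "'a \<times> real"
  assumes "simple_system \<Delta>"
    and "span \<Delta> = UNIV"
    and "\<forall>\<beta>\<in>positive_roots \<Delta>. snd \<beta> \<noteq> 0"
    and "\<forall>\<alpha>\<in>\<Delta>. lorB e_last \<alpha> < 0"
    and "x0 \<in> proj_model"
  shows "orbit_limit_points \<Delta> x0 = limit_roots \<Delta>"
proof -
  interpret future_simple_system \<Delta>
    using assms(1,4) by unfold_locales auto
  have "x0 \<in> future_cone"
    using assms(5) proj_model_subset_future_cone by blast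
  then have "orbit_limit_points \<Delta> x0 = orbit_limit_points \<Delta> e_last"
    using orbit_limit_points_subset e_last_in_future_cone by blast
  also have "\<dots> = limit_roots \<Delta>"
    using limit_roots_subset_orbit_limit_points orbit_limit_points_subset_limit_roots[OF assms(2)]
    by blast
  finally show ?thesis .
qed

end
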